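(* Let $c>0$ and let $\alpha,\beta$ be real numbers with $\beta+1\notin\{0,-1,-2,\dots\}$, $\alpha(\beta+1)>0$, and such that the weight $$\rho(x)=\frac{(\alpha)_x}{(\beta+1)_x}\frac{c^x}{x!},\qquad x\in\mathbb{N}_0,$$ is positive for all $x\in\mathbb{N}_0$. Let $P_n^{(1,1)}$ be its monic orthogonal polynomials (generalized Meixner polynomials). For $\alpha_2>c$ let $P_{n,\alpha_2}^{(2,1)}$ be the monic orthogonal polynomials with respect to $$\rho_{\alpha_2}(x)=\frac{(\alpha)_x(\alpha_2)_x}{(\beta+1)_x}\frac{(c/\alpha_2)^x}{x!},\qquad x\in\mathbb{N}_0$$ (generalized Hahn polynomials of type I with parameters $\alpha,\alpha_2,\beta$ and $c/\alpha_2$). Then for every $n\in\mathbb{N}_0$ and every $x$, $$\lim_{\alpha_2\to\infty}P_{n,\alpha_2}^{(2,1)}(x)=P_n^{(1,1)}(x).$$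
   Context: $(a)_x=a(a+1)\cdots(a+x-1)$, $(a)_0=1$, is the Pochhammer symbol, and $\mathbb{N}_0$ is the set of nonnegative integers. Given a positive weight $\rho$ with finite moments on $\mathbb{N}_0$, the monic orthogonal polynomials $P_n$ with respect to $\rho$ are the monic polynomials of degree $n$ satisfying $\sum_{x=0}^\infty P_n(x)x^k\rho(x)=0$ for $0\le k<n$. *)

theory Defs
  imports Complex_Main "HOL-Library.Nonpos_Ints" "HOL-Computational_Algebra.Polynomial"
begin

definition generalized_meixner_weight :: "real \<Rightarrow> real \<Rightarrow> real \<Rightarrow> nat \<Rightarrow> real" where
  "generalized_meixner_weight \<alpha> \<beta> c x =
     pochhammer \<alpha> x / pochhammer (\<beta> + 1) x * (c ^ x / fact x)"

definition generalized_hahn_weight :: "real \<Rightarrow> real \<Rightarrow> real \<Rightarrow> real \<Rightarrow> nat \<Rightarrow> real" where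
  "generalized_hahn_weight \<alpha>\<^sub>1 \<alpha>\<^sub>2 \<beta> c x =
     pochhammer \<alpha>\<^sub>1 x * pochhammer \<alpha>\<^sub>2 x / pochhammer (\<beta> + 1) x * (c ^ x / fact x)"

definition monic_orthogonal_poly :: "(nat \<Rightarrow> real) \<Rightarrow> nat \<Rightarrow> real poly \<Rightarrow> bool" where
  "monic_orthogonal_poly \<rho> n p \<longleftrightarrow>
     degree p = n \<and> lead_coeff p = 1 \<and>
     (\<forall>k<n. (\<lambda>x. poly p (real x) * real x ^ k * \<rho> x) sums 0)"

text \<open>For a positive weight with finite moments the predicate above determines exactly one
  polynomial in each degree, so that one may speak of \emph{the} monic orthogonal polynomials.\<close>

context
  fixes \<rho> :: "nat \<Rightarrow> real"
  assumes pos: "\<And>x. \<rho> x > 0"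
    and moments: "\<And>k. summable (\<lambda>x. real x ^ k * \<rho> x)"
begin

lemma summable_poly_weight: "summable (\<lambda>x. poly p (real x) * \<rho> x)"
proof -
  have "(\<lambda>x. poly p (real x) * \<rho> x) =
        (\<lambda>x. \<Sum>i\<le>degree p. coeff p i * (real x ^ i * \<rho> x))"
    by (simp add: poly_altdef sum_distrib_right mult.assoc)
  then show ?thesis
    by (simp add: summable_sum summable_mult moments)
qed

private definition L :: "real poly \<Rightarrow> real" where
  "L p = (\<Sum>x. poly p (real x) * \<rho> x)"

private lemma L_add: "L (p + q) = L p + L q"
  unfolding L_def using suminf_add[OF summable_poly_weight summable_poly_weight, of p q]
  by (simp add: algebra_simps)

private lemma L_smult: "L (smult a p) = a * L p"
  unfolding L_def using suminf_mult[OF summable_poly_weight, of a p]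
  by (simp add: algebra_simps)

private lemma L_0: "L 0 = 0"
  by (simp add: L_def)

private lemma L_diff: "L (p - q) = L p - L q"
  using L_add[of p "smult (-1) q"] L_smult[of "-1" q] by simp

private lemma L_sum: "finite A \<Longrightarrow> L (\<Sum>i\<in>A. f i) = (\<Sum>i\<in>A. L (f i))"
  by (induction A rule: finite_induct) (auto simp: L_0 L_add)

private lemma L_square_eq_0: "L (p * p) = 0 \<Longrightarrow> p = 0"
proof (rule ccontr)
  assume 0: "L (p * p) = 0" and p: "p \<noteq> 0"
  have "poly (p * p) (real x) * \<rho> x = 0" for x
    using 0 summable_poly_weight[of "p * p"] pos[THEN less_imp_le]
    unfolding L_def by (subst (asm) suminf_eq_zero_iff) auto
  then have "poly p (real x) = 0" for x
    using pos[of x] by (auto simp: less_le)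
  then have "range real \<subseteq> {x. poly p x = 0}" by auto
  then have "finite (range real)"
    using poly_roots_finite[OF p] finite_subset by blast
  then show False by (simp add: finite_image_iff inj_on_def)
qed

private lemma monic_orthogonal_poly_L:
  "monic_orthogonal_poly \<rho> n p \<longleftrightarrow>
     degree p = n \<and> lead_coeff p = 1 \<and> (\<forall>k<n. L (p * monom 1 k) = 0)"
proof -
  have "(\<lambda>x. poly p (real x) * real x ^ k * \<rho> x) sums 0 \<longleftrightarrow> L (p * monom 1 k) = 0" for k
    using summable_poly_weight[of "p * monom 1 k"]
    by (auto simp: L_def poly_monom sums_iff)
  then show ?thesis by (simp add: monic_orthogonal_poly_def)
qed

private lemma orthogonal_lower_degree:
  assumes "\<And>k. k < n \<Longrightarrow> L (p * monom 1 k) = 0" "q = 0 \<or> degree q < n"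
  shows "L (p * q) = 0"
proof (cases "q = 0")
  case False
  have "p * q = (\<Sum>i\<le>degree q. smult (coeff q i) (p * monom 1 i))"
  proof -
    have "p * q = p * (\<Sum>i\<le>degree q. monom (coeff q i) i)"
      by (simp only: poly_as_sum_of_monoms)
    also have "\<dots> = (\<Sum>i\<le>degree q. p * smult (coeff q i) (monom 1 i))"
      by (simp add: sum_distrib_left smult_monom)
    finally show ?thesis by (simp only: mult_smult_right)
  qed
  then show ?thesis using assms False by (auto simp: L_sum L_smult)
qed (simp add: L_0)

private lemma monic_diff_lower_degree:
  fixes p q :: "real poly"
  assumes "degree p = n" "degree q = n" "lead_coeff p = 1" "lead_coeff q = 1"
  shows "p - q = 0 \<or> degree (p - q) < n"
proof (rule disjCI)
  assume "\<not> degree (p - q) < n"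
  moreover have "degree (p - q) \<le> n"
    using assms by (intro degree_diff_le) simp_all
  ultimately have "degree (p - q) = n" by simp
  moreover have "coeff (p - q) n = 0" using assms by simp
  ultimately show "p - q = 0" using leading_coeff_0_iff[of "p - q"] by simp
qed

lemma monic_orthogonal_poly_ex: "\<exists>p. monic_orthogonal_poly \<rho> n p"
proof (induction n rule: less_induct)
  case (less n)
  then obtain P where P: "\<And>k. k < n \<Longrightarrow> monic_orthogonal_poly \<rho> k (P k)" by metis
  have deg: "degree (P k) = k" "lead_coeff (P k) = 1" if "k < n" for k
    using P[OF that] by (auto simp: monic_orthogonal_poly_def)
  have ort: "L (P j * P k) = 0" if "j < n" "k < n" "j \<noteq> k" for j k
  proof -
    have *: "L (P i * P j) = 0" if "j < i" "i < n" for i j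
      by (rule orthogonal_lower_degree[of i];
          use P[of i] that deg in \<open>auto simp: monic_orthogonal_poly_L\<close>)
    show ?thesis using *[of j k] *[of k j] that by (cases "j < k") (auto simp: mult.commute)
  qed
  have nz: "L (P k * P k) \<noteq> 0" if "k < n" for k
    using L_square_eq_0[of "P k"] deg[OF that] by auto
  define r where "r = (\<Sum>k<n. smult (L (monom 1 n * P k) / L (P k * P k)) (P k))"
  define p where "p = monom 1 n - r"
  have "coeff r i = 0" if "n \<le> i" for i
    unfolding r_def coeff_sum using that deg
    by (intro sum.neutral) (auto intro!: coeff_eq_0)
  then have c: "coeff p i = (if i = n then 1 else 0)" if "n \<le> i" for i
    using that by (auto simp: p_def)
  then have degp: "degree p = n"
    by (intro antisym degree_le le_degree) auto
  have pP: "L (p * P k) = 0" if k: "k < n" for k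
  proof -
    have "L (r * P k) = (\<Sum>j<n. L (monom 1 n * P j) / L (P j * P j) * L (P j * P k))"
      by (simp add: r_def sum_distrib_right L_sum L_smult)
    also have "\<dots> = (\<Sum>j<n. if j = k then L (monom 1 n * P k) else 0)"
      using nz ort k by (intro sum.cong) auto
    finally show ?thesis using k by (simp add: p_def left_diff_distrib L_diff)
  qed
  have "L (p * monom 1 k) = 0" if "k < n" for k
    using that
  proof (induction k rule: less_induct)
    case (less k)
    have "L (p * (monom 1 k - P k)) = 0"
    proof (rule orthogonal_lower_degree[of k])
      show "monom 1 k - P k = 0 \<or> degree (monom 1 k - P k) < k"
        using less.prems deg[of k]
        by (intro monic_diff_lower_degree) (auto simp: degree_monom_eq)
    qed (use less in auto)
    then show ?case using pP[of k] less by (simp add: right_diff_distrib L_diff)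
  qed
  then show ?case using c degp by (auto simp: monic_orthogonal_poly_L)
qed

lemma monic_orthogonal_poly_unique:
  assumes "monic_orthogonal_poly \<rho> n p" "monic_orthogonal_poly \<rho> n q"
  shows "p = q"
proof -
  have d: "p - q = 0 \<or> degree (p - q) < n"
    using assms by (intro monic_diff_lower_degree) (auto simp: monic_orthogonal_poly_def)
  have "L (p * (p - q)) = 0" "L (q * (p - q)) = 0"
    by (rule orthogonal_lower_degree[OF _ d]; use assms in \<open>auto simp: monic_orthogonal_poly_L\<close>)+
  then have "L ((p - q) * (p - q)) = 0"
    by (simp add: left_diff_distrib[of p q] L_diff)
  then show ?thesis using L_square_eq_0[of "p - q"] by simp
qed

end

end

theory Submission
  imports Defs "HOL-Analysis.Uniform_Limit" "HOL-Real_Asymp.Real_Asymp"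
begin

text \<open>Writing \<open>w\<close> for the Meixner weight, the Hahn weight is
  \<open>W t x = w x * (\<Prod>i<x. 1 + i / t)\<close>, which decreases to \<open>w x\<close> as \<open>t\<close> tends to infinity.
  Let \<open>L\<close> and \<open>L t\<close> be the two moment functionals and \<open>P\<close>, \<open>Q t\<close> the monic orthogonal
  polynomials of degree \<open>n\<close>. By Pythagoras, the inequality \<open>w \<le> W t\<close> and the minimality of
  \<open>Q t\<close>, we get \<open>L ((Q t - P)\<^sup>2) = L ((Q t)\<^sup>2) - L (P\<^sup>2) \<le> L t (P\<^sup>2) - L (P\<^sup>2)\<close>. The right-hand side
  tends to 0 by dominated convergence, so \<open>Q t\<close> converges to \<open>P\<close> at every natural number and,
  by interpolation, everywhere.\<close>

section \<open>Lagrange interpolation and pointwise limits of polynomials\<close>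

lemma poly_lagrange_interpolation:
  fixes p :: "'a :: field poly"
  assumes "finite A" "degree p < card A"
  shows "poly p x = (\<Sum>a\<in>A. poly p a * (\<Prod>b\<in>A-{a}. (x - b) / (a - b)))"
proof -
  \<comment> \<open>The Lagrange basis polynomial of the node \<open>a\<close>: 1 at
    \<open>a\<close> and 0 at the other nodes. The interpolant built from these and \<open>p\<close>
    have degree below \<open>card A\<close> and agree on \<open>A\<close>, so they coincide.\<close>
  define l where "l a = (\<Prod>b\<in>A-{a}. smult (inverse (a - b)) [:-b, 1:])" for a
  have l: "poly (l a) y = (\<Prod>b\<in>A-{a}. (y - b) / (a - b))" for a y
    unfolding l_def poly_prod by (simp add: divide_inverse algebra_simps)
  have "degree (l a) < card A" if "a \<in> A" for a
  proof -
    have "degree (l a) \<le> (\<Sum>b\<in>A-{a}. 1)"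
      unfolding l_def using assms(1)
      by (intro order.trans[OF degree_prod_sum_le] sum_mono) (auto intro: degree_smult_le[THEN order.trans])
    also have "\<dots> < card A"
      using card_Diff1_less[OF assms(1) that] by simp
    finally show ?thesis .
  qed
  then have "degree (\<Sum>a\<in>A. smult (poly p a) (l a)) < card A"
    using assms by (intro degree_sum_less) (auto intro: le_less_trans[OF degree_smult_le])
  moreover have "poly p y = poly (\<Sum>a\<in>A. smult (poly p a) (l a)) y" if "y \<in> A" for y
  proof -
    have "poly (l a) y = (if a = y then 1 else 0)" if "a \<in> A" for a
      unfolding l using assms(1) \<open>y \<in> A\<close> that by (auto intro!: prod.neutral bexI[of _ y])
    then have "(\<Sum>a\<in>A. poly p a * poly (l a) y) = (\<Sum>a\<in>A. if a = y then poly p a else 0)"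
      by (intro sum.cong) auto
    then show ?thesis
      using assms(1) that by (simp add: poly_sum)
  qed
  ultimately have "p = (\<Sum>a\<in>A. smult (poly p a) (l a))"
    using assms by (intro poly_eqI_degree[of A])
  then have "poly p x = poly (\<Sum>a\<in>A. smult (poly p a) (l a)) x" by simp
  then show ?thesis by (simp add: poly_sum l)
qed

text \<open>The Lagrange coefficients at \<open>x\<close> do not depend on \<open>t\<close>, so
  \<open>poly (Q t) x\<close> is eventually a fixed finite linear combination of the values on
  \<open>A\<close>, whose limits are known.\<close>

lemma poly_tendsto_interpolation:
  fixes Q :: "'b \<Rightarrow> 'a :: real_normed_field poly"
  assumes A: "finite A" "degree P < card A" "\<forall>\<^sub>F t in F. degree (Q t) < card A"
    and lim: "\<And>a. a \<in> A \<Longrightarrow> ((\<lambda>t. poly (Q t) a) \<longlongrightarrow> poly P a) F"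
  shows "((\<lambda>t. poly (Q t) x) \<longlongrightarrow> poly P x) F"
proof -
  have "((\<lambda>t. \<Sum>a\<in>A. poly (Q t) a * (\<Prod>b\<in>A-{a}. (x - b) / (a - b))) \<longlongrightarrow> poly P x) F"
    unfolding poly_lagrange_interpolation[OF A(1,2), of x]
    by (intro tendsto_sum tendsto_mult lim tendsto_const)
  then show ?thesis
    by (rule Lim_transform_eventually)
      (use A in \<open>auto elim!: eventually_mono simp: poly_lagrange_interpolation[of A _ x]\<close>)
qed

section \<open>Extremal property of monic orthogonal polynomials\<close>

text \<open>Linearity extends orthogonality from powers to \<open>q\<close>. The condition is put on
  coefficients because \<open>degree q < n\<close> would exclude \<open>q = 0\<close> when
  \<open>n = 0\<close>.\<close>

lemma monic_orthogonal_poly_orthogonal: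
  assumes "monic_orthogonal_poly \<rho> n p" "\<And>i. i \<ge> n \<Longrightarrow> coeff q i = 0"
  shows "(\<lambda>x. poly (p * q) (real x) * \<rho> x) sums 0"
proof -
  have "poly q y = (\<Sum>i<n. coeff q i * y ^ i)" for y
    unfolding poly_altdef using assms(2)
    by (intro sum.mono_neutral_cong) (auto simp: not_less coeff_eq_0)
  then have "(\<lambda>x. poly (p * q) (real x) * \<rho> x) =
      (\<lambda>x. \<Sum>i<n. coeff q i * (poly p (real x) * real x ^ i * \<rho> x))"
    by (simp add: sum_distrib_left sum_distrib_right mult_ac)
  moreover have "\<dots> sums (\<Sum>i<n. coeff q i * 0)"
    using assms(1) by (intro sums_sum sums_mult) (auto simp: monic_orthogonal_poly_def)
  ultimately show ?thesis by simp
qed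

text \<open>The leading terms of \<open>q\<close> and \<open>p\<close> cancel, so
  \<open>q - p\<close> is orthogonal to \<open>p\<close> and the cross term in the square of
  \<open>p + (q - p)\<close> vanishes.\<close>

lemma monic_orthogonal_poly_pythagoras:
  assumes \<rho>: "\<And>x. \<rho> x > 0" "\<And>k. summable (\<lambda>x. real x ^ k * \<rho> x)"
    and p: "monic_orthogonal_poly \<rho> n p" and q: "degree q = n" "lead_coeff q = 1"
  shows "(\<Sum>x. poly (q\<^sup>2) (real x) * \<rho> x) =
    (\<Sum>x. poly (p\<^sup>2) (real x) * \<rho> x) + (\<Sum>x. poly ((q - p)\<^sup>2) (real x) * \<rho> x)"
proof -
  note summable = summable_poly_weight[of \<rho>, OF \<rho>]
  have "coeff (q - p) i = 0" if "i \<ge> n" for i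
    using that p q by (cases "i = n") (auto simp: monic_orthogonal_poly_def coeff_eq_0)
  from monic_orthogonal_poly_orthogonal[OF p this]
  have "(\<lambda>x. poly (p\<^sup>2) (real x) * \<rho> x + poly ((q - p)\<^sup>2) (real x) * \<rho> x +
      2 * (poly (p * (q - p)) (real x) * \<rho> x)) sums
      ((\<Sum>x. poly (p\<^sup>2) (real x) * \<rho> x) + (\<Sum>x. poly ((q - p)\<^sup>2) (real x) * \<rho> x) + 2 * 0)"
    by (intro sums_add sums_mult summable_sums summable)
  also have "(\<lambda>x. poly (p\<^sup>2) (real x) * \<rho> x + poly ((q - p)\<^sup>2) (real x) * \<rho> x +
      2 * (poly (p * (q - p)) (real x) * \<rho> x)) = (\<lambda>x. poly (q\<^sup>2) (real x) * \<rho> x)"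
    by (simp add: fun_eq_iff algebra_simps power2_eq_square)
  finally show ?thesis by (simp add: sums_iff)
qed

lemma monic_orthogonal_poly_diff_square_le:
  assumes w: "\<And>x. w x > 0" "\<And>x. w x \<le> W x" and W: "\<And>k. summable (\<lambda>x. real x ^ k * W x)"
    and p: "monic_orthogonal_poly w n p" and q: "monic_orthogonal_poly W n q"
  shows "(poly (q - p) (real m))\<^sup>2 * w m \<le>
    (\<Sum>x. poly (p\<^sup>2) (real x) * W x) - (\<Sum>x. poly (p\<^sup>2) (real x) * w x)"
proof -
  have W_pos: "W x > 0" for x using w[of x] by linarith
  have moments: "summable (\<lambda>x. real x ^ k * w x)" for k
    by (rule summable_comparison_test'[OF W[of k], of 0])
      (use w in \<open>auto simp: abs_mult less_imp_le mult_left_mono\<close>)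
  have summable: "summable (\<lambda>x. poly r (real x) * w x)" "summable (\<lambda>x. poly r (real x) * W x)" for r
    using summable_poly_weight[of w] summable_poly_weight[of W] w W W_pos moments by auto
  \<comment> \<open>All terms of the series are nonnegative, so the one at \<open>m\<close> is at
    most the sum.\<close>
  have "(poly (q - p) (real m))\<^sup>2 * w m \<le> (\<Sum>x. poly ((q - p)\<^sup>2) (real x) * w x)"
    using sum_le_suminf[OF summable(1), of "{m}" "(q - p)\<^sup>2"] w(1)
    by (simp add: less_imp_le)
  also have "\<dots> = (\<Sum>x. poly (q\<^sup>2) (real x) * w x) - (\<Sum>x. poly (p\<^sup>2) (real x) * w x)"
    using monic_orthogonal_poly_pythagoras[OF w(1) moments p, of q] q
    unfolding monic_orthogonal_poly_def by linarith
  also have "(\<Sum>x. poly (q\<^sup>2) (real x) * w x) \<le> (\<Sum>x. poly (q\<^sup>2) (real x) * W x)"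
    using w by (intro suminf_le summable) (simp add: mult_left_mono)
  \<comment> \<open>Minimality of \<open>q\<close> for \<open>W\<close>: Pythagoras is applied with
    the roles exchanged, \<open>q\<close> being the orthogonal polynomial and \<open>p\<close> the
    monic competitor.\<close>
  also have "\<dots> \<le> (\<Sum>x. poly (p\<^sup>2) (real x) * W x)"
  proof -
    have "0 \<le> (\<Sum>x. poly ((p - q)\<^sup>2) (real x) * W x)"
      using W_pos by (intro suminf_nonneg summable) (simp add: less_imp_le)
    then show ?thesis
      using monic_orthogonal_poly_pythagoras[OF W_pos W q, of p] p
      unfolding monic_orthogonal_poly_def by linarith
  qed
  finally show ?thesis by simp
qed

section \<open>Convergence under a dominated, decreasing perturbation of the weight\<close>

lemma monic_orthogonal_poly_tendsto:
  fixes W :: "'a \<Rightarrow> nat \<Rightarrow> real"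
  assumes F: "F \<noteq> bot" and w: "\<And>x. w x > 0"
    and bounds: "\<forall>\<^sub>F t in F. \<forall>x. w x \<le> W t x \<and> W t x \<le> \<sigma> x"
    and \<sigma>: "\<And>k. summable (\<lambda>x. real x ^ k * \<sigma> x)"
    and lim: "\<And>x. ((\<lambda>t. W t x) \<longlongrightarrow> w x) F"
    and p: "monic_orthogonal_poly w n p"
    and q: "\<forall>\<^sub>F t in F. monic_orthogonal_poly (W t) n (q t)"
  shows "((\<lambda>t. poly (q t) x) \<longlongrightarrow> poly p x) F"
proof -
  define D where "D t = (\<Sum>x. poly (p\<^sup>2) (real x) * W t x) - (\<Sum>x. poly (p\<^sup>2) (real x) * w x)" for t
  \<comment> \<open>Since \<open>F\<close> is nontrivial, the bounds hold for at least one
    \<open>t\<close>; this makes \<sigma> positive, because it lies above \<open>w\<close>.\<close>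
  obtain t where "\<forall>x. w x \<le> W t x \<and> W t x \<le> \<sigma> x"
    using eventually_happens'[OF F bounds] by blast
  then have \<sigma>_pos: "\<sigma> x > 0" for x
    using w[of x] by (meson less_le_trans)
  have "((\<lambda>t. \<Sum>x. poly (p\<^sup>2) (real x) * W t x) \<longlongrightarrow> (\<Sum>x. poly (p\<^sup>2) (real x) * w x)) F"
  proof -
    have summable: "summable (\<lambda>x. poly (p\<^sup>2) (real x) * \<sigma> x)"
      using summable_poly_weight[of \<sigma>] \<sigma>_pos \<sigma> by blast
    \<comment> \<open>Tannery's theorem wants the bound along the product filter. It holds for every
      \<open>x\<close> at once, so the condition on \<open>x\<close> is simply
      \<open>True\<close>.\<close>
    have bound: "\<forall>\<^sub>F (x, t) in at_top \<times>\<^sub>F F.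
        norm (poly (p\<^sup>2) (real x) * W t x) \<le> poly (p\<^sup>2) (real x) * \<sigma> x"
      unfolding eventually_prod_filter
    proof (intro exI conjI allI impI)
      show "\<forall>\<^sub>F x :: nat in at_top. True" by simp
      fix x t assume "\<forall>x. w x \<le> W t x \<and> W t x \<le> \<sigma> x"
      then have "0 < W t x" "W t x \<le> \<sigma> x"
        using w[of x] by (meson less_le_trans)+
      then show "case (x, t) of (x, t) \<Rightarrow>
          norm (poly (p\<^sup>2) (real x) * W t x) \<le> poly (p\<^sup>2) (real x) * \<sigma> x"
        by (simp add: abs_mult mult_left_mono)
    qed (rule bounds)
    have "((\<lambda>t. poly (p\<^sup>2) (real x) * W t x) \<longlongrightarrow> poly (p\<^sup>2) (real x) * w x) F" for x
      by (intro tendsto_mult_left lim)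
    from tannerys_theorem[of "\<lambda>x t. poly (p\<^sup>2) (real x) * W t x"
        "\<lambda>x. poly (p\<^sup>2) (real x) * w x" F "\<lambda>x. poly (p\<^sup>2) (real x) * \<sigma> x",
        OF this bound summable F]
    show ?thesis by (elim conjE)
  qed
  then have D: "(D \<longlongrightarrow> 0) F"
    unfolding D_def by (simp add: LIM_zero_iff)
  have diff: "\<forall>\<^sub>F t in F. (poly (q t - p) (real m))\<^sup>2 \<le> D t / w m" for m
    using bounds q
  proof eventually_elim
    case (elim t)
    have "summable (\<lambda>x. real x ^ k * W t x)" for k
    proof (rule summable_comparison_test'[OF \<sigma>[of k], of 0])
      fix x
      have "0 < W t x" "W t x \<le> \<sigma> x"
        using elim(1) w[of x] by (meson less_le_trans)+
      then show "norm (real x ^ k * W t x) \<le> real x ^ k * \<sigma> x"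
        by (simp add: abs_mult mult_left_mono)
    qed
    with monic_orthogonal_poly_diff_square_le[OF w _ _ p elim(2), of m] elim(1)
    show ?case using w[of m] by (simp add: D_def pos_le_divide_eq)
  qed
  have at_nat: "((\<lambda>t. poly (q t) (real m)) \<longlongrightarrow> poly p (real m)) F" for m
  proof -
    have "((\<lambda>t. D t / w m) \<longlongrightarrow> 0 / w m) F"
      using w[of m] by (intro tendsto_intros D) auto
    then have "((\<lambda>t. (poly (q t - p) (real m))\<^sup>2) \<longlongrightarrow> 0) F"
      by (intro tendsto_sandwich[OF _ diff tendsto_const]) auto
    then have "((\<lambda>t. poly (q t) (real m) - poly p (real m)) \<longlongrightarrow> 0) F"
      by (simp add: power_tendsto_0_iff)
    then show ?thesis by (rule LIM_zero_cancel)
  qed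
  \<comment> \<open>The \<open>n + 1\<close> nodes 0, ..., \<open>n\<close> suffice for polynomials
    of degree \<open>n\<close>.\<close>
  have "card (real ` {..n}) = Suc n"
    by (simp add: card_image)
  moreover have "\<forall>\<^sub>F t in F. degree (q t) < Suc n"
    using q by (rule eventually_mono) (simp add: monic_orthogonal_poly_def)
  ultimately show ?thesis
    using p at_nat poly_tendsto_interpolation[of "real ` {..n}" p q F x]
    by (auto simp: monic_orthogonal_poly_def)
qed

section \<open>The Hahn and Meixner weights\<close>

text \<open>Taking \<open>t\<close> out of each factor of \<open>pochhammer t x\<close> gives
  \<open>t ^ x\<close>, which cancels the denominator of \<open>(c / t) ^ x\<close>.\<close>

lemma generalized_hahn_weight_eq_meixner:
  assumes "t \<noteq> 0"
  shows "generalized_hahn_weight \<alpha> t \<beta> (c / t) x =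
    generalized_meixner_weight \<alpha> \<beta> c x * (\<Prod>i<x. 1 + real i / t)"
proof -
  have "pochhammer t x = t ^ x * (\<Prod>i<x. 1 + real i / t)"
  proof (induction x)
    case (Suc x)
    have "t + real x = t * (1 + real x / t)"
      using assms by (simp add: distrib_left)
    then show ?case by (simp add: Suc pochhammer_Suc)
  qed simp
  then show ?thesis
    using assms
    by (simp add: generalized_hahn_weight_def generalized_meixner_weight_def power_divide)
qed

lemma summable_generalized_hahn_weight_moments:
  assumes "c > 0" "t > c" and pos: "\<And>x. generalized_meixner_weight \<alpha> \<beta> c x > 0"
  shows "summable (\<lambda>x. real x ^ k * generalized_hahn_weight \<alpha> t \<beta> (c / t) x)"
proof -
  let ?h = "generalized_hahn_weight \<alpha> t \<beta> (c / t)"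
  \<comment> \<open>The ratio of consecutive terms of the moment series for \<open>x > 0\<close>,
    its first factor coming from the powers \<open>real x ^ k\<close>. It tends to
    \<open>c / t < 1\<close>.\<close>
  define r where "r x = ((real x + 1) / real x) ^ k *
    ((\<alpha> + real x) * (t + real x) / (\<beta> + 1 + real x) * (c / t / (real x + 1)))" for x :: nat
  have t: "t > 0" using assms by simp
  have Suc: "?h (Suc x) = ?h x *
      ((\<alpha> + real x) * (t + real x) / (\<beta> + 1 + real x) * (c / t / (real x + 1)))" for x
    by (simp add: generalized_hahn_weight_def pochhammer_Suc add_ac mult_ac)
  obtain q where q: "c / t < q" "q < 1"
    using dense[of "c / t" 1] assms t by auto
  have "r \<longlonglongrightarrow> 1 ^ k * (c / t)"
    unfolding r_def
  proof (intro tendsto_mult tendsto_power)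
    show "(\<lambda>x. (real x + 1) / real x) \<longlonglongrightarrow> 1" by real_asymp
    show "(\<lambda>x. (\<alpha> + real x) * (t + real x) / (\<beta> + 1 + real x) * (c / t / (real x + 1)))
        \<longlonglongrightarrow> c / t"
      using assms(1) t by real_asymp
  qed
  then have "r \<longlonglongrightarrow> c / t" by simp
  moreover have "c / t > 0" using assms t by simp
  \<comment> \<open>Positivity of \<open>r x\<close> lets it leave the absolute value;
    \<open>x > 0\<close> is needed to cancel \<open>real x ^ k\<close>.\<close>
  ultimately have "\<forall>\<^sub>F x in sequentially. r x < q \<and> r x > 0 \<and> x > 0"
    using q by (intro eventually_conj eventually_gt_at_top) (auto dest: order_tendstoD)
  then obtain N where N: "r x < q" "r x > 0" "x > 0" if "x \<ge> N" for x
    by (auto simp: eventually_sequentially)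
  show ?thesis
  proof (rule summable_ratio_test[OF q(2), of N])
    fix x assume "x \<ge> N"
    note N = N[OF this]
    have "real (Suc x) ^ k * ?h (Suc x) = r x * (real x ^ k * ?h x)"
      using N(3) unfolding Suc r_def by (simp add: power_divide add_ac)
    then have "norm (real (Suc x) ^ k * ?h (Suc x)) = r x * norm (real x ^ k * ?h x)"
      using N(2) by (simp only: real_norm_def abs_mult[of "r x"] abs_of_pos)
    also have "\<dots> \<le> q * norm (real x ^ k * ?h x)"
      using N(1) by (intro mult_right_mono) auto
    finally show "norm (real (Suc x) ^ k * ?h (Suc x)) \<le> q * norm (real x ^ k * ?h x)" .
  qed
qed

theorem mainTheorem3:
  fixes c \<alpha> \<beta> :: real
    and P :: "nat \<Rightarrow> real poly"
    and Q :: "real \<Rightarrow> nat \<Rightarrow> real poly"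
  assumes "c > 0"
    and "\<beta> + 1 \<notin> \<int>\<^sub>\<le>\<^sub>0"
    and "\<alpha> * (\<beta> + 1) > 0"
    and "\<And>x. generalized_meixner_weight \<alpha> \<beta> c x > 0"
    and "\<And>n. monic_orthogonal_poly (generalized_meixner_weight \<alpha> \<beta> c) n (P n)"
    and "\<And>\<alpha>\<^sub>2 n. \<alpha>\<^sub>2 > c \<Longrightarrow>
           monic_orthogonal_poly (generalized_hahn_weight \<alpha> \<alpha>\<^sub>2 \<beta> (c / \<alpha>\<^sub>2)) n (Q \<alpha>\<^sub>2 n)"
  shows "\<forall>(n::nat) (x::real). ((\<lambda>\<alpha>\<^sub>2. poly (Q \<alpha>\<^sub>2 n) x) \<longlongrightarrow> poly (P n) x) at_top"
proof (intro allI)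
  fix n :: nat and x :: real
  let ?w = "generalized_meixner_weight \<alpha> \<beta> c"
  let ?W = "\<lambda>t. generalized_hahn_weight \<alpha> t \<beta> (c / t)"
  show "((\<lambda>\<alpha>\<^sub>2. poly (Q \<alpha>\<^sub>2 n) x) \<longlongrightarrow> poly (P n) x) at_top"
  \<comment> \<open>The Hahn weight decreases in the parameter, so its value at \<open>c + 1\<close>
    dominates all later ones; as \<open>c + 1 > c\<close>, its moments are finite.\<close>
  proof (rule monic_orthogonal_poly_tendsto[where w = ?w and W = ?W and \<sigma> = "?W (c + 1)"])
    show "summable (\<lambda>x. real x ^ k * ?W (c + 1) x)" for k
      using assms by (intro summable_generalized_hahn_weight_moments) auto
    show "\<forall>\<^sub>F t in at_top. \<forall>x. ?w x \<le> ?W t x \<and> ?W t x \<le> ?W (c + 1) x"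
      using eventually_ge_at_top[of "c + 1"]
    proof (eventually_elim, intro allI)
      fix t :: real and x :: nat assume t: "c + 1 \<le> t"
      have "1 \<le> (\<Prod>i<x. 1 + real i / t)"
        using t assms(1) by (intro prod_ge_1) auto
      moreover have "(\<Prod>i<x. 1 + real i / t) \<le> (\<Prod>i<x. 1 + real i / (c + 1))"
        using t assms(1) by (intro prod_mono) (auto intro!: divide_left_mono)
      ultimately show "?w x \<le> ?W t x \<and> ?W t x \<le> ?W (c + 1) x"
        using assms(4)[of x] t assms(1) by (simp add: generalized_hahn_weight_eq_meixner)
    qed
    show "((\<lambda>t. ?W t x) \<longlongrightarrow> ?w x) at_top" for x
    proof -
      have "((\<lambda>t. ?w x * (\<Prod>i<x. 1 + real i / t)) \<longlongrightarrow> ?w x * (\<Prod>i<x. 1 + 0)) at_top"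
        by (intro tendsto_intros real_tendsto_divide_at_top[OF tendsto_const] filterlim_ident)
      moreover have "\<forall>\<^sub>F t in at_top. ?w x * (\<Prod>i<x. 1 + real i / t) = ?W t x"
        using eventually_gt_at_top[of 0]
        by eventually_elim (simp add: generalized_hahn_weight_eq_meixner)
      ultimately show ?thesis by (simp add: Lim_transform_eventually)
    qed
    show "\<forall>\<^sub>F t in at_top. monic_orthogonal_poly (?W t) n (Q t n)"
      using eventually_gt_at_top[of c] assms(6) by (rule eventually_mono)
  qed (use assms in auto)
qed

end
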